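(* Let $\phi : S \to \Sigma$ be a homomorphism of inverse semigroups, and let $K = \{ s \in S : \phi(s) \in E(\Sigma) \}$. Then $K$ is a normal inverse subsemigroup of $S$, and $\phi$ factorises as a composition $$ S \xrightarrow{\ \pi\ } S/\!/K \xrightarrow{\ \kappa\ } \Sigma $$ where $\pi(s) = [s]_K$ and where $\kappa$, defined by $\kappa([s]_K) = \phi(s)$, is a (well-defined) star-injective functor from the groupoid $S/\!/K$ to $\Sigma$ regarded as a groupoid under trace products.
   Context: For an inverse semigroup $S$, $E(S)$ is its semilattice of idempotents and $\leq$ its natural partial order. A product $st$ is a trace product, written $s\cdot t$, when $s^{-1}s = tt^{-1}$; writing $a\cdot s\cdot b$ asserts $a^{-1}a = ss^{-1}$ and $s^{-1}s = bb^{-1}$. An inverse semigroup is regarded as an (ordered) groupoid with set of identities $E(S)$ and composition the trace product, $s$ having domain $ss^{-1}$ and range $s^{-1}s$. An inverse subsemigroup $N$ of $S$ is normal if $E(N)=E(S)$ and $s^{-1}ns\in N$ for all $s\in S$, $n\in N$. For normal $N$, define $s\leq_N t$ iff there exist $a,b\in N$ with $a\cdot s\cdot b\leq t$, and $s\simeq_N t$ iff $s\leq_N t$ and $t\leq_N s$ (an equivalence relation). $[s]_N$ is the $\simeq_N$-class of $s$ and $S/\!/N = S/{\simeq_N}$. $S/\!/N$ is a groupoid (indeed an ordered groupoid, ordered by $\leq_N$): the identities are the classes $[e]_N$, $e\in E(S)$; $[s]_N$ has domain $[ss^{-1}]_N$, range $[s^{-1}s]_N$, inverse $[s^{-1}]_N$;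 and if $s^{-1}s\simeq_N tt^{-1}$ the composition of $[s]_N$ and $[t]_N$ is $[sat]_N$ for any $a\in N$ with $aa^{-1}\leq s^{-1}s$ and $a^{-1}a=tt^{-1}$ (such $a$ exists, and the class is independent of choices). For a groupoid $G$ and identity $e$, $\mathrm{star}_G(e)=\{g\in G: gg^{-1}=e\}$; a functor $\theta:G\to H$ is star-injective if for each identity $e$ of $G$ its restriction $\mathrm{star}_G(e)\to\mathrm{star}_H(\theta(e))$ is injective. *)

theory Defs
  imports "HOL-Algebra.Congruence" "HOL-Library.FuncSet"
begin

section \<open>Inverse semigroups\<close>

record 'a sgp = "'a partial_object" +
  smult :: "'a \<Rightarrow> 'a \<Rightarrow> 'a" (infixl "\<odot>\<index>" 70)

locale inverse_semigroup =
  fixes S :: "('a, 'm) sgp_scheme" (structure)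
  assumes closed: "\<lbrakk>x \<in> carrier S; y \<in> carrier S\<rbrakk> \<Longrightarrow> x \<odot> y \<in> carrier S"
    and assoc: "\<lbrakk>x \<in> carrier S; y \<in> carrier S; z \<in> carrier S\<rbrakk>
                  \<Longrightarrow> (x \<odot> y) \<odot> z = x \<odot> (y \<odot> z)"
    and ex1_inverse: "x \<in> carrier S
                  \<Longrightarrow> \<exists>!y. y \<in> carrier S \<and> x \<odot> y \<odot> x = x \<and> y \<odot> x \<odot> y = y"

definition sinv :: "('a, 'm) sgp_scheme \<Rightarrow> 'a \<Rightarrow> 'a" where
  "sinv S x = (THE y. y \<in> carrier S \<and> x \<odot>\<^bsub>S\<^esub> y \<odot>\<^bsub>S\<^esub> x = x \<and> y \<odot>\<^bsub>S\<^esub> x \<odot>\<^bsub>S\<^esub> y = y)"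

definition idempotents :: "('a, 'm) sgp_scheme \<Rightarrow> 'a set" where
  "idempotents S = {e \<in> carrier S. e \<odot>\<^bsub>S\<^esub> e = e}"

definition natural_le :: "('a, 'm) sgp_scheme \<Rightarrow> 'a \<Rightarrow> 'a \<Rightarrow> bool" where
  "natural_le S s t \<longleftrightarrow>
     s \<in> carrier S \<and> t \<in> carrier S \<and> (\<exists>e \<in> idempotents S. s = e \<odot>\<^bsub>S\<^esub> t)"

definition sgp_hom :: "('a, 'm) sgp_scheme \<Rightarrow> ('b, 'n) sgp_scheme \<Rightarrow> ('a \<Rightarrow> 'b) set" where
  "sgp_hom S T = {f \<in> carrier S \<rightarrow> carrier T.
     \<forall>x \<in> carrier S. \<forall>y \<in> carrier S. f (x \<odot>\<^bsub>S\<^esub> y) = f x \<odot>\<^bsub>T\<^esub> f y}"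

definition inverse_subsemigroup :: "'a set \<Rightarrow> ('a, 'm) sgp_scheme \<Rightarrow> bool" where
  "inverse_subsemigroup N S \<longleftrightarrow> N \<subseteq> carrier S \<and>
     (\<forall>x \<in> N. \<forall>y \<in> N. x \<odot>\<^bsub>S\<^esub> y \<in> N) \<and> (\<forall>x \<in> N. sinv S x \<in> N)"

definition normal_inverse_subsemigroup :: "'a set \<Rightarrow> ('a, 'm) sgp_scheme \<Rightarrow> bool" where
  "normal_inverse_subsemigroup N S \<longleftrightarrow> inverse_subsemigroup N S \<and>
     {e \<in> N. e \<odot>\<^bsub>S\<^esub> e = e} = idempotents S \<and>
     (\<forall>s \<in> carrier S. \<forall>n \<in> N. sinv S s \<odot>\<^bsub>S\<^esub> n \<odot>\<^bsub>S\<^esub> s \<in> N)"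

definition trace_composable :: "('a, 'm) sgp_scheme \<Rightarrow> 'a \<Rightarrow> 'a \<Rightarrow> bool" where
  "trace_composable S s t \<longleftrightarrow> sinv S s \<odot>\<^bsub>S\<^esub> s = t \<odot>\<^bsub>S\<^esub> sinv S t"

section \<open>Groupoids\<close>

text \<open>A groupoid is given by its arrows, the identities being among them. Composition is
  written in diagrammatic order: \<open>gcomp G g h\<close> is meaningful only if
  \<open>gran G g = gdom G h\<close>, and its value is unspecified otherwise.\<close>

record 'a gpd =
  arrows :: "'a set"
  idents :: "'a set"
  gdom :: "'a \<Rightarrow> 'a"
  gran :: "'a \<Rightarrow> 'a"
  gcomp :: "'a \<Rightarrow> 'a \<Rightarrow> 'a"
  ginv :: "'a \<Rightarrow> 'a"

locale groupoid =
  fixes G :: "('a, 'm) gpd_scheme"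
  assumes idents_arrows: "idents G \<subseteq> arrows G"
    and dom_ident: "g \<in> arrows G \<Longrightarrow> gdom G g \<in> idents G"
    and ran_ident: "g \<in> arrows G \<Longrightarrow> gran G g \<in> idents G"
    and ident_dom: "e \<in> idents G \<Longrightarrow> gdom G e = e"
    and ident_ran: "e \<in> idents G \<Longrightarrow> gran G e = e"
    and comp_arrow: "\<lbrakk>g \<in> arrows G; h \<in> arrows G; gran G g = gdom G h\<rbrakk>
          \<Longrightarrow> gcomp G g h \<in> arrows G"
    and dom_comp: "\<lbrakk>g \<in> arrows G; h \<in> arrows G; gran G g = gdom G h\<rbrakk>
          \<Longrightarrow> gdom G (gcomp G g h) = gdom G g"
    and ran_comp: "\<lbrakk>g \<in> arrows G; h \<in> arrows G; gran G g = gdom G h\<rbrakk>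
          \<Longrightarrow> gran G (gcomp G g h) = gran G h"
    and comp_assoc: "\<lbrakk>g \<in> arrows G; h \<in> arrows G; k \<in> arrows G;
                       gran G g = gdom G h; gran G h = gdom G k\<rbrakk>
          \<Longrightarrow> gcomp G (gcomp G g h) k = gcomp G g (gcomp G h k)"
    and ident_comp: "g \<in> arrows G \<Longrightarrow> gcomp G (gdom G g) g = g"
    and comp_ident: "g \<in> arrows G \<Longrightarrow> gcomp G g (gran G g) = g"
    and inv_arrow: "g \<in> arrows G \<Longrightarrow> ginv G g \<in> arrows G"
    and dom_inv: "g \<in> arrows G \<Longrightarrow> gdom G (ginv G g) = gran G g"
    and ran_inv: "g \<in> arrows G \<Longrightarrow> gran G (ginv G g) = gdom G g"
    and comp_inv: "g \<in> arrows G \<Longrightarrow> gcomp G g (ginv G g) = gdom G g"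
    and inv_comp: "g \<in> arrows G \<Longrightarrow> gcomp G (ginv G g) g = gran G g"

locale groupoid_functor = G: groupoid G + H: groupoid H
  for G :: "('a, 'm) gpd_scheme" and H :: "('b, 'n) gpd_scheme" +
  fixes \<theta> :: "'a \<Rightarrow> 'b"
  assumes map_arrows: "g \<in> arrows G \<Longrightarrow> \<theta> g \<in> arrows H"
    and map_idents: "e \<in> idents G \<Longrightarrow> \<theta> e \<in> idents H"
    and map_dom: "g \<in> arrows G \<Longrightarrow> \<theta> (gdom G g) = gdom H (\<theta> g)"
    and map_ran: "g \<in> arrows G \<Longrightarrow> \<theta> (gran G g) = gran H (\<theta> g)"
    and map_comp: "\<lbrakk>g \<in> arrows G; h \<in> arrows G; gran G g = gdom G h\<rbrakk>
          \<Longrightarrow> \<theta> (gcomp G g h) = gcomp H (\<theta> g) (\<theta> h)"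

definition star :: "('a, 'm) gpd_scheme \<Rightarrow> 'a \<Rightarrow> 'a set" where
  "star G e = {g \<in> arrows G. gcomp G g (ginv G g) = e}"

definition star_injective ::
    "('a, 'm) gpd_scheme \<Rightarrow> ('b, 'n) gpd_scheme \<Rightarrow> ('a \<Rightarrow> 'b) \<Rightarrow> bool" where
  "star_injective G H \<theta> \<longleftrightarrow>
     (\<forall>e \<in> idents G. \<theta> ` star G e \<subseteq> star H (\<theta> e) \<and> inj_on \<theta> (star G e))"

definition trace_groupoid :: "('a, 'm) sgp_scheme \<Rightarrow> 'a gpd" where
  "trace_groupoid S = \<lparr>
     arrows = carrier S,
     idents = idempotents S,
     gdom = (\<lambda>s. s \<odot>\<^bsub>S\<^esub> sinv S s),
     gran = (\<lambda>s. sinv S s \<odot>\<^bsub>S\<^esub> s),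
     gcomp = (\<lambda>s t. s \<odot>\<^bsub>S\<^esub> t),
     ginv = sinv S\<rparr>"

section \<open>The quotient by a normal inverse subsemigroup\<close>

definition normal_le :: "('a, 'm) sgp_scheme \<Rightarrow> 'a set \<Rightarrow> 'a \<Rightarrow> 'a \<Rightarrow> bool" where
  "normal_le S N s t \<longleftrightarrow> s \<in> carrier S \<and> t \<in> carrier S \<and>
     (\<exists>a \<in> N. \<exists>b \<in> N. trace_composable S a s \<and> trace_composable S s b \<and>
        natural_le S (a \<odot>\<^bsub>S\<^esub> s \<odot>\<^bsub>S\<^esub> b) t)"

definition normal_rel :: "('a, 'm) sgp_scheme \<Rightarrow> 'a set \<Rightarrow> ('a \<times> 'a) set" where
  "normal_rel S N = {(s, t). normal_le S N s t \<and> normal_le S N t s}"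

definition normal_class :: "('a, 'm) sgp_scheme \<Rightarrow> 'a set \<Rightarrow> 'a \<Rightarrow> 'a set" where
  "normal_class S N s = normal_rel S N `` {s}"

text \<open>Each operation on classes is the union of the classes obtained from all choices of
  representatives (and, for composition, of the connecting element \<open>a\<close>). If the
  resulting class does not depend on the choices, the union is that class.\<close>

definition quotient_groupoid :: "('a, 'm) sgp_scheme \<Rightarrow> 'a set \<Rightarrow> 'a set gpd" where
  "quotient_groupoid S N = \<lparr>
     arrows = carrier S // normal_rel S N,
     idents = normal_class S N ` idempotents S,
     gdom = (\<lambda>X. \<Union>s \<in> X. normal_class S N (s \<odot>\<^bsub>S\<^esub> sinv S s)),
     gran = (\<lambda>X. \<Union>s \<in> X. normal_class S N (sinv S s \<odot>\<^bsub>S\<^esub> s)),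
     gcomp = (\<lambda>X Y. \<Union>{normal_class S N (s \<odot>\<^bsub>S\<^esub> a \<odot>\<^bsub>S\<^esub> t) | s a t.
       s \<in> X \<and> t \<in> Y \<and> a \<in> N \<and>
       natural_le S (a \<odot>\<^bsub>S\<^esub> sinv S a) (sinv S s \<odot>\<^bsub>S\<^esub> s) \<and>
       sinv S a \<odot>\<^bsub>S\<^esub> a = t \<odot>\<^bsub>S\<^esub> sinv S t}),
     ginv = (\<lambda>X. \<Union>s \<in> X. normal_class S N (sinv S s))\<rparr>"

end

theory Submission
  imports Defs
begin

text \<open>A \<open>\<simeq>\<^sub>K\<close>-class is determined by \<open>\<phi> s\<close> and the class of the domain \<open>s s\<^sup>-\<^sup>1\<close>: an element
  \<open>a \<in> K\<close> linking the domains satisfies \<open>\<phi> a = \<phi> (s s\<^sup>-\<^sup>1)\<close>, and \<open>b = s\<^sup>-\<^sup>1 a\<^sup>-\<^sup>1 t\<close> completes it to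
  \<open>a \<cdot> s \<cdot> b \<le> t\<close> with \<open>b \<in> K\<close> as soon as \<open>\<phi> s = \<phi> t\<close>. This is
  star-injectivity, and it also reduces the groupoid laws in \<open>S//K\<close> to comparing values of
  \<open>\<phi>\<close> and domains.\<close>

section \<open>Inverses and idempotents\<close>

context inverse_semigroup
begin

declare closed [simp] assoc [simp]

lemma sinv_props:
  assumes "x \<in> carrier S"
  shows sinv_closed [simp]: "sinv S x \<in> carrier S"
    and mult_sinv_mult: "x \<odot> (sinv S x \<odot> x) = x"
    and sinv_mult_sinv: "sinv S x \<odot> (x \<odot> sinv S x) = sinv S x"
  using theI'[OF ex1_inverse[OF assms]] assms unfolding sinv_def[symmetric] by auto

lemma sinv_equality:
  assumes "x \<in> carrier S" "y \<in> carrier S" "x \<odot> (y \<odot> x) = x" "y \<odot> (x \<odot> y) = y"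
  shows "sinv S x = y"
  unfolding sinv_def by (rule the1_equality[OF ex1_inverse]) (use assms in auto)

lemma sinv_sinv [simp]: "x \<in> carrier S \<Longrightarrow> sinv S (sinv S x) = x"
  by (rule sinv_equality) (simp_all add: mult_sinv_mult sinv_mult_sinv)

declare mult_sinv_mult [simp] sinv_mult_sinv [simp]

text \<open>With \<open>assoc\<close> as a rewrite rule products become right-nested, so the
  cancellation law is also needed with a further factor \<open>y\<close> behind it.\<close>

lemma mult_sinv_mult_assoc [simp]:
  "x \<in> carrier S \<Longrightarrow> y \<in> carrier S \<Longrightarrow> x \<odot> (sinv S x \<odot> (x \<odot> y)) = x \<odot> y"
  by (metis assoc closed mult_sinv_mult sinv_closed)

lemma sinv_mult_sinv_assoc [simp]:
  "x \<in> carrier S \<Longrightarrow> y \<in> carrier S \<Longrightarrow> sinv S x \<odot> (x \<odot> (sinv S x \<odot> y)) = sinv S x \<odot> y"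
  by (metis mult_sinv_mult_assoc sinv_closed sinv_sinv)

lemma idempotents_iff: "e \<in> idempotents S \<longleftrightarrow> e \<in> carrier S \<and> e \<odot> e = e"
  by (simp add: idempotents_def)

lemma idempotent_assoc:
  "e \<in> idempotents S \<Longrightarrow> x \<in> carrier S \<Longrightarrow> e \<odot> (e \<odot> x) = e \<odot> x"
  by (metis assoc idempotents_iff)

lemma sinv_idempotent: "e \<in> idempotents S \<Longrightarrow> sinv S e = e"
  by (rule sinv_equality) (simp_all add: idempotents_iff)

text \<open>If \<open>x\<close> is the inverse of \<open>e \<odot> f\<close>, then
  \<open>f \<odot> (x \<odot> e)\<close> is an inverse as well, so the two coincide by uniqueness.
  The second form is idempotent because \<open>x \<odot> (e \<odot> (f \<odot> x)) = x\<close>.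
  Idempotents are self-inverse, so \<open>e \<odot> f\<close> equals \<open>x\<close>.\<close>

lemma idempotent_mult:
  assumes "e \<in> idempotents S" "f \<in> idempotents S"
  shows "e \<odot> f \<in> idempotents S"
proof -
  note e = assms(1)[unfolded idempotents_iff] and f = assms(2)[unfolded idempotents_iff]
  define x where "x = sinv S (e \<odot> f)"
  have "x \<in> carrier S" "e \<odot> f \<odot> (x \<odot> (e \<odot> f)) = e \<odot> f" "x \<odot> (e \<odot> f \<odot> x) = x"
    unfolding x_def using e f by (blast intro: mult_sinv_mult sinv_mult_sinv sinv_closed closed)+
  then have x: "x \<in> carrier S" "e \<odot> (f \<odot> (x \<odot> (e \<odot> f))) = e \<odot> f" "x \<odot> (e \<odot> (f \<odot> x)) = x"
    using e f by simp_all
  have x3: "x \<odot> (e \<odot> (f \<odot> (x \<odot> y))) = x \<odot> y" if "y \<in> carrier S" for y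
    using arg_cong[OF x(3), of "\<lambda>z. z \<odot> y"] that x(1) e f by simp
  have "x = f \<odot> (x \<odot> e)"
    unfolding x_def
    by (rule sinv_equality)
      (use x x3 e f assms in \<open>simp_all flip: x_def add: idempotent_assoc\<close>)
  moreover have "f \<odot> (x \<odot> e) \<odot> (f \<odot> (x \<odot> e)) = f \<odot> (x \<odot> e)"
    using x x3 e f by simp
  ultimately have idem: "x \<in> idempotents S"
    using x(1) by (simp add: idempotents_iff)
  have "e \<odot> f = sinv S x"
    using e f by (simp add: x_def)
  then show ?thesis
    using sinv_idempotent[OF idem] idem by simp
qed

text \<open>Both products are idempotent, which makes \<open>f \<odot> e\<close> an inverse of
  \<open>e \<odot> f\<close>; but \<open>e \<odot> f\<close> is its own inverse.\<close>

lemma idempotent_commute: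
  assumes "e \<in> idempotents S" "f \<in> idempotents S"
  shows "e \<odot> f = f \<odot> e"
proof -
  have c: "e \<in> carrier S" "f \<in> carrier S"
    using assms by (simp_all add: idempotents_iff)
  have "e \<odot> (f \<odot> (e \<odot> f)) = e \<odot> f" "f \<odot> (e \<odot> (f \<odot> e)) = f \<odot> e"
    using idempotent_mult[of e f] idempotent_mult[of f e] assms c by (simp_all add: idempotents_iff)
  then have "sinv S (e \<odot> f) = f \<odot> e"
    by (intro sinv_equality) (simp_all add: c idempotent_assoc assms)
  then show ?thesis
    using sinv_idempotent[OF idempotent_mult[OF assms]] by simp
qed

lemma mult_sinv_idempotent [simp]: "x \<in> carrier S \<Longrightarrow> x \<odot> sinv S x \<in> idempotents S"
  by (simp add: idempotents_iff)

lemma sinv_mult_idempotent [simp]: "x \<in> carrier S \<Longrightarrow> sinv S x \<odot> x \<in> idempotents S"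
  by (simp add: idempotents_iff)

lemma sinv_mult [simp]:
  assumes x: "x \<in> carrier S" and y: "y \<in> carrier S"
  shows "sinv S (x \<odot> y) = sinv S y \<odot> sinv S x"
proof (rule sinv_equality)
  \<comment> \<open>Swapping the two idempotents that meet between \<open>x\<close> and
    \<open>y\<close> brings each next to the factor that absorbs it.\<close>
  have comm: "y \<odot> sinv S y \<odot> (sinv S x \<odot> x) = sinv S x \<odot> x \<odot> (y \<odot> sinv S y)"
    by (rule idempotent_commute) (use x y in simp_all)
  show "x \<odot> y \<odot> (sinv S y \<odot> sinv S x \<odot> (x \<odot> y)) = x \<odot> y"
    using arg_cong[OF comm, of "\<lambda>z. x \<odot> (z \<odot> y)"] x y by simp
  show "sinv S y \<odot> sinv S x \<odot> (x \<odot> y \<odot> (sinv S y \<odot> sinv S x)) = sinv S y \<odot> sinv S x"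
    using arg_cong[OF comm[symmetric], of "\<lambda>z. sinv S y \<odot> (z \<odot> sinv S x)"] x y by simp
qed (use x y in simp_all)

text \<open>The conjugate is the range idempotent of \<open>e \<odot> x\<close>.\<close>

lemma conj_idempotent:
  assumes "x \<in> carrier S" "e \<in> idempotents S"
  shows "sinv S x \<odot> (e \<odot> x) \<in> idempotents S"
proof -
  have e: "e \<in> carrier S" "sinv S e = e" "e \<odot> e = e"
    using assms sinv_idempotent by (simp_all add: idempotents_iff)
  have "sinv S (e \<odot> x) \<odot> (e \<odot> x) = sinv S x \<odot> (e \<odot> x)"
    using e assms by (simp add: idempotent_assoc)
  then show ?thesis
    by (metis assms(1) closed e(1) sinv_mult_idempotent)
qed

section \<open>The natural partial order and the trace groupoid\<close>

lemma natural_leD: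
  assumes "natural_le S s t"
  shows "t \<odot> (sinv S t \<odot> s) = s" and "s \<odot> (sinv S t \<odot> t) = s"
proof -
  obtain e where e: "e \<in> idempotents S" "s = e \<odot> t" and t: "t \<in> carrier S"
    using assms by (auto simp: natural_le_def)
  have ec: "e \<in> carrier S"
    using e by (simp add: idempotents_iff)
  show "s \<odot> (sinv S t \<odot> t) = s"
    using e ec t by simp
  \<comment> \<open>The idempotent in \<open>s = e \<odot> t\<close> stands on the left, so
    absorption from the left requires commuting it past \<open>t t\<^sup>-\<^sup>1\<close>.\<close>
  have "t \<odot> sinv S t \<odot> e = e \<odot> (t \<odot> sinv S t)"
    by (rule idempotent_commute) (use e t in simp_all)
  from arg_cong[OF this, of "\<lambda>z. z \<odot> t"] show "t \<odot> (sinv S t \<odot> s) = s"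
    using e ec t by simp
qed

lemma natural_le_antisym:
  assumes "natural_le S s t" "natural_le S t s"
  shows "s = t"
proof -
  obtain e f where e: "e \<in> idempotents S" "s = e \<odot> t" and f: "f \<in> idempotents S" "t = f \<odot> s"
    and c: "s \<in> carrier S" "t \<in> carrier S"
    using assms unfolding natural_le_def by metis
  have "e \<odot> t = t"
  proof -
    have ec: "e \<in> carrier S" "f \<in> carrier S"
      using e f by (simp_all add: idempotents_iff)
    have "e \<odot> t = e \<odot> f \<odot> s"
      using f(2) ec c by simp
    also have "\<dots> = f \<odot> e \<odot> (e \<odot> t)"
      using idempotent_commute[OF e(1) f(1)] e(2) by simp
    also have "\<dots> = f \<odot> (e \<odot> t)"
      using idempotent_assoc[OF e(1)] ec c by simp
    also have "\<dots> = t"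
      using e f by simp
    finally show ?thesis .
  qed
  then show ?thesis
    using e by simp
qed

lemma groupoid_trace_groupoid: "groupoid (trace_groupoid S)"
proof
  fix g h assume "g \<in> arrows (trace_groupoid S)" "h \<in> arrows (trace_groupoid S)"
    and "gran (trace_groupoid S) g = gdom (trace_groupoid S) h"
  then have g: "g \<in> carrier S" and h: "h \<in> carrier S" and gh: "sinv S g \<odot> g = h \<odot> sinv S h"
    by (simp_all add: trace_groupoid_def)
  \<comment> \<open>Composability replaces the inner \<open>h h\<^sup>-\<^sup>1\<close> of
    \<open>g h h\<^sup>-\<^sup>1 g\<^sup>-\<^sup>1\<close> by \<open>g\<^sup>-\<^sup>1 g\<close>,
    which cancels; ranges are dual.\<close>
  show "gdom (trace_groupoid S) (gcomp (trace_groupoid S) g h) = gdom (trace_groupoid S) g"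
    using arg_cong[OF gh, of "\<lambda>z. g \<odot> z \<odot> sinv S g"] g h by (simp add: trace_groupoid_def)
  show "gran (trace_groupoid S) (gcomp (trace_groupoid S) g h) = gran (trace_groupoid S) h"
    using arg_cong[OF gh, of "\<lambda>z. sinv S h \<odot> z \<odot> h"] g h by (simp add: trace_groupoid_def)
qed (auto simp: trace_groupoid_def idempotents_iff sinv_idempotent)

end

section \<open>The kernel of a homomorphism\<close>

locale inverse_semigroup_hom = S: inverse_semigroup S + T: inverse_semigroup T
  for S :: "('a, 'm) sgp_scheme" (structure) and T :: "('b, 'n) sgp_scheme" +
  fixes \<phi> :: "'a \<Rightarrow> 'b"
  assumes hom: "\<phi> \<in> sgp_hom S T"
begin

definition K :: "'a set" where
  "K = {s \<in> carrier S. \<phi> s \<in> idempotents T}"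

lemma phi_closed [simp]: "x \<in> carrier S \<Longrightarrow> \<phi> x \<in> carrier T"
  using hom by (auto simp: sgp_hom_def)

lemma phi_mult [simp]:
  "x \<in> carrier S \<Longrightarrow> y \<in> carrier S \<Longrightarrow> \<phi> (x \<odot> y) = \<phi> x \<odot>\<^bsub>T\<^esub> \<phi> y"
  using hom by (auto simp: sgp_hom_def)

lemma phi_sinv [simp]:
  assumes "x \<in> carrier S"
  shows "\<phi> (sinv S x) = sinv T (\<phi> x)"
proof (rule T.sinv_equality[symmetric])
  show "\<phi> x \<odot>\<^bsub>T\<^esub> (\<phi> (sinv S x) \<odot>\<^bsub>T\<^esub> \<phi> x) = \<phi> x"
    by (metis assms S.closed S.mult_sinv_mult S.sinv_closed phi_mult)
  show "\<phi> (sinv S x) \<odot>\<^bsub>T\<^esub> (\<phi> x \<odot>\<^bsub>T\<^esub> \<phi> (sinv S x)) = \<phi> (sinv S x)"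
    by (metis assms S.closed S.sinv_mult_sinv S.sinv_closed phi_mult)
qed (use assms in simp_all)

lemma phi_idempotent: "e \<in> idempotents S \<Longrightarrow> \<phi> e \<in> idempotents T"
  by (metis S.idempotents_iff T.idempotents_iff phi_closed phi_mult)

lemma K_closed [simp]: "a \<in> K \<Longrightarrow> a \<in> carrier S"
  and phi_K: "a \<in> K \<Longrightarrow> \<phi> a \<in> idempotents T"
  and K_I: "a \<in> carrier S \<Longrightarrow> \<phi> a \<in> idempotents T \<Longrightarrow> a \<in> K"
  by (simp_all add: K_def)

lemma K_idempotent: "e \<in> idempotents S \<Longrightarrow> e \<in> K"
  using K_I phi_idempotent S.idempotents_iff by blast

lemma K_mult: "a \<in> K \<Longrightarrow> b \<in> K \<Longrightarrow> a \<odot> b \<in> K"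
  by (rule K_I) (simp_all add: phi_K T.idempotent_mult)

lemma K_sinv: "a \<in> K \<Longrightarrow> sinv S a \<in> K"
  by (rule K_I) (simp_all add: phi_K T.sinv_idempotent)

lemma K_conj: "s \<in> carrier S \<Longrightarrow> a \<in> K \<Longrightarrow> sinv S s \<odot> (a \<odot> s) \<in> K"
  by (rule K_I) (simp_all add: phi_K T.conj_idempotent)

lemma normal_K: "normal_inverse_subsemigroup K S"
  unfolding normal_inverse_subsemigroup_def inverse_subsemigroup_def
proof (intro conjI)
  show "{e \<in> K. e \<odot> e = e} = idempotents S"
    using K_idempotent S.idempotents_iff K_closed by blast
qed (auto simp: K_mult K_sinv K_conj)

text \<open>Idempotents of \<open>T\<close> are self-inverse, so \<open>\<phi> a\<close> can be read
  off from the domain or the range of \<open>a\<close>. This computes the images of linking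
  elements.\<close>

lemma phi_K_dom: "a \<in> K \<Longrightarrow> \<phi> (a \<odot> sinv S a) = \<phi> a"
  and phi_K_ran: "a \<in> K \<Longrightarrow> \<phi> (sinv S a \<odot> a) = \<phi> a"
  using phi_K[of a] by (simp_all add: T.sinv_idempotent T.idempotents_iff)

text \<open>On idempotents \<open>linked e f\<close> is the preorder \<open>e \<le>\<^sub>K f\<close>; the condition
  \<open>f a = a\<close> says \<open>a a\<^sup>-\<^sup>1 \<le> f\<close>.\<close>

definition linked :: "'a \<Rightarrow> 'a \<Rightarrow> bool" where
  "linked e f \<longleftrightarrow> (\<exists>a \<in> K. sinv S a \<odot> a = e \<and> f \<odot> a = a)"

lemma linked_refl: "e \<in> idempotents S \<Longrightarrow> linked e e"
  unfolding linked_def by (rule bexI[where x = e], rule conjI)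
    (simp_all add: S.sinv_idempotent K_idempotent S.idempotents_iff[THEN iffD1])

text \<open>The links \<open>a\<close> and \<open>b\<close> compose to \<open>b \<odot> a\<close>:
  since \<open>f = b\<^sup>-\<^sup>1 b\<close> fixes \<open>a\<close>, the range of the product is
  still that of \<open>a\<close>.\<close>

lemma linked_trans:
  assumes "linked e f" "linked f g" and "g \<in> carrier S"
  shows "linked e g"
proof -
  obtain a b where a: "a \<in> K" "sinv S a \<odot> a = e" "f \<odot> a = a"
    and b: "b \<in> K" "sinv S b \<odot> b = f" "g \<odot> b = b"
    using assms unfolding linked_def by metis
  have "sinv S b \<odot> b \<odot> a = a"
    by (simp only: a(3) b(2))
  then have "sinv S b \<odot> (b \<odot> a) = a"
    using a(1) b(1) by simp
  then have "sinv S (b \<odot> a) \<odot> (b \<odot> a) = e"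
    using a(1,2) b(1) by simp
  moreover have "g \<odot> (b \<odot> a) = b \<odot> a"
    using arg_cong[OF b(3), of "\<lambda>z. z \<odot> a"] a(1) b(1) assms(3) by simp
  ultimately show ?thesis
    unfolding linked_def using K_mult a b by metis
qed

text \<open>Let \<open>a \<cdot> s \<cdot> b \<le> t\<close>. The images of \<open>a\<close> and
  \<open>b\<close> are the domain and range identities of \<open>\<phi> s\<close>, so
  \<open>a s b\<close> has image \<open>\<phi> s\<close>. The links of the domains and of the ranges
  are \<open>a\<close> and \<open>b\<^sup>-\<^sup>1\<close>.\<close>

lemma normal_leD:
  assumes "normal_le S K s t"
  shows "natural_le T (\<phi> s) (\<phi> t)"
    and "linked (s \<odot> sinv S s) (t \<odot> sinv S t)"
    and "linked (sinv S s \<odot> s) (sinv S t \<odot> t)"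
proof -
  obtain a b where a: "a \<in> K" "sinv S a \<odot> a = s \<odot> sinv S s"
    and b: "b \<in> K" "b \<odot> sinv S b = sinv S s \<odot> s"
    and le: "natural_le S (a \<odot> s \<odot> b) t" and c: "s \<in> carrier S" "t \<in> carrier S"
    using assms unfolding normal_le_def trace_composable_def by metis
  have "\<phi> a = \<phi> s \<odot>\<^bsub>T\<^esub> sinv T (\<phi> s)" "\<phi> b = sinv T (\<phi> s) \<odot>\<^bsub>T\<^esub> \<phi> s"
    using phi_K_ran[OF a(1)] phi_K_dom[OF b(1)] a b c by simp_all
  then have "\<phi> (a \<odot> s \<odot> b) = \<phi> s"
    using a b c by simp
  then show "natural_le T (\<phi> s) (\<phi> t)"
    using le c phi_idempotent unfolding natural_le_def
    by (metis S.idempotents_iff phi_closed phi_mult)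
  \<comment> \<open>Cancelling \<open>s \<odot> b\<close> on the right recovers \<open>a\<close>, so
    \<open>t t\<^sup>-\<^sup>1\<close> fixes \<open>a\<close> because it fixes
    \<open>a s b\<close>.\<close>
  have "a \<odot> s \<odot> b \<odot> (sinv S b \<odot> sinv S s) = a"
  proof -
    have "a \<odot> s \<odot> b \<odot> (sinv S b \<odot> sinv S s) = a \<odot> s \<odot> (b \<odot> sinv S b) \<odot> sinv S s"
      using a(1) b(1) c by simp
    also have "\<dots> = a \<odot> (s \<odot> sinv S s)"
      using a(1) c by (simp add: b(2))
    also have "\<dots> = a"
      using a(1) by (simp flip: a(2))
    finally show ?thesis .
  qed
  moreover have "t \<odot> sinv S t \<odot> (a \<odot> s \<odot> b \<odot> (sinv S b \<odot> sinv S s))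
      = a \<odot> s \<odot> b \<odot> (sinv S b \<odot> sinv S s)"
    using arg_cong[OF S.natural_leD(1)[OF le], of "\<lambda>z. z \<odot> (sinv S b \<odot> sinv S s)"] a b c by simp
  ultimately have "t \<odot> sinv S t \<odot> a = a"
    by simp
  then show "linked (s \<odot> sinv S s) (t \<odot> sinv S t)"
    unfolding linked_def using a by metis
  \<comment> \<open>Dually, cancelling \<open>a \<odot> s\<close> on the left recovers
    \<open>b\<close>, which therefore absorbs \<open>t\<^sup>-\<^sup>1 t\<close> on the
    right.\<close>
  have "sinv S s \<odot> sinv S a \<odot> (a \<odot> s \<odot> b) = b"
  proof -
    have "sinv S s \<odot> sinv S a \<odot> (a \<odot> s \<odot> b) = sinv S s \<odot> (sinv S a \<odot> a) \<odot> (s \<odot> b)"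
      using a(1) b(1) c by simp
    also have "\<dots> = sinv S s \<odot> s \<odot> b"
      using b(1) c by (simp add: a(2))
    also have "\<dots> = b"
      using b(1) by (simp flip: b(2))
    finally show ?thesis .
  qed
  moreover have "sinv S s \<odot> sinv S a \<odot> (a \<odot> s \<odot> b) \<odot> (sinv S t \<odot> t)
      = sinv S s \<odot> sinv S a \<odot> (a \<odot> s \<odot> b)"
    using arg_cong[OF S.natural_leD(2)[OF le], of "\<lambda>z. sinv S s \<odot> sinv S a \<odot> z"] a b c by simp
  ultimately have "b \<odot> (sinv S t \<odot> t) = b"
    by simp
  \<comment> \<open>A link has to be fixed from the left, hence the passage to
    \<open>b\<^sup>-\<^sup>1\<close>.\<close>
  from arg_cong[OF this, of "sinv S"] have "sinv S t \<odot> t \<odot> sinv S b = sinv S b"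
    using b c by simp
  then show "linked (sinv S s \<odot> s) (sinv S t \<odot> t)"
    unfolding linked_def using b K_sinv by (metis S.sinv_sinv K_closed)
qed

lemma normal_leI:
  assumes c: "s \<in> carrier S" "t \<in> carrier S" and eq: "\<phi> s = \<phi> t"
    and "linked (s \<odot> sinv S s) (t \<odot> sinv S t)"
  shows "normal_le S K s t"
proof -
  obtain a where a: "a \<in> K" "sinv S a \<odot> a = s \<odot> sinv S s" "t \<odot> sinv S t \<odot> a = a"
    using assms unfolding linked_def by metis
  \<comment> \<open>This is \<open>(a s)\<^sup>-\<^sup>1 t\<close>, chosen so that
    \<open>a s b\<close> becomes \<open>a a\<^sup>-\<^sup>1 t\<close>, a restriction of
    \<open>t\<close>.\<close>
  define b where "b = sinv S s \<odot> (sinv S a \<odot> t)"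
  have "sinv T (\<phi> a) = \<phi> s \<odot>\<^bsub>T\<^esub> sinv T (\<phi> s)"
    using phi_K_ran[OF a(1)] a c T.sinv_idempotent[OF phi_K[OF a(1)]] by simp
  then have "\<phi> b = \<phi> (sinv S s \<odot> s)"
    using a c by (simp add: b_def eq)
  then have b: "b \<in> K"
    using a c by (intro K_I) (simp_all add: b_def)
  have ta: "t \<odot> (sinv S t \<odot> (a \<odot> s)) = a \<odot> s"
    using arg_cong[OF a(3), of "\<lambda>z. z \<odot> s"] a(1) c by simp
  have "b \<odot> sinv S b = sinv S s \<odot> (sinv S a \<odot> a) \<odot> s"
    using a(1) c by (simp add: b_def ta)
  also have "\<dots> = sinv S s \<odot> s"
    using c by (simp add: a(2))
  finally have bb: "b \<odot> sinv S b = sinv S s \<odot> s" .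
  have "a \<odot> s \<odot> b = a \<odot> (s \<odot> sinv S s) \<odot> (sinv S a \<odot> t)"
    using a(1) c by (simp add: b_def)
  also have "\<dots> = a \<odot> sinv S a \<odot> t"
    using a(1) c by (simp flip: a(2))
  finally have "natural_le S (a \<odot> s \<odot> b) t"
    unfolding natural_le_def using a(1) b c by (metis S.closed S.mult_sinv_idempotent K_closed)
  then show ?thesis
    unfolding normal_le_def trace_composable_def using a(1,2) b bb c by metis
qed

text \<open>Two comparisons in opposite directions give
  \<open>\<phi> s \<le> \<phi> t \<le> \<phi> s\<close>, hence equality by antisymmetry in
  \<open>T\<close>. The converse is \<open>normal_leI\<close> applied both ways. Later arguments use
  this form instead of pairs \<open>a\<close>, \<open>b\<close>.\<close>

lemma rel_iff:
  "(s, t) \<in> normal_rel S K \<longleftrightarrow> s \<in> carrier S \<and> t \<in> carrier S \<and> \<phi> s = \<phi> t \<and>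
     linked (s \<odot> sinv S s) (t \<odot> sinv S t) \<and> linked (t \<odot> sinv S t) (s \<odot> sinv S s)"
proof
  assume "(s, t) \<in> normal_rel S K"
  then have st: "normal_le S K s t" "normal_le S K t s"
    by (simp_all add: normal_rel_def)
  have "\<phi> s = \<phi> t"
    using T.natural_le_antisym st normal_leD(1) by metis
  then show "s \<in> carrier S \<and> t \<in> carrier S \<and> \<phi> s = \<phi> t \<and>
     linked (s \<odot> sinv S s) (t \<odot> sinv S t) \<and> linked (t \<odot> sinv S t) (s \<odot> sinv S s)"
    using st normal_leD(2) by (auto simp: normal_le_def)
qed (simp add: normal_rel_def normal_leI)

lemma equiv_rel: "equiv (carrier S) (normal_rel S K)"
proof (rule equivI)
  show "normal_rel S K \<subseteq> carrier S \<times> carrier S"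
    by (auto simp: rel_iff)
  show "refl_on (carrier S) (normal_rel S K)"
    by (rule refl_onI) (auto simp: rel_iff linked_refl)
  show "sym (normal_rel S K)"
    by (rule symI) (auto simp: rel_iff)
  show "trans (normal_rel S K)"
    by (rule transI) (auto simp: rel_iff intro: linked_trans)
qed

section \<open>Classes and their invariants\<close>

abbreviation cls :: "'a \<Rightarrow> 'a set" where
  "cls \<equiv> normal_class S K"

lemma cls_eq_iff:
  assumes "s \<in> carrier S" "t \<in> carrier S"
  shows "cls s = cls t \<longleftrightarrow> (s, t) \<in> normal_rel S K"
  using eq_equiv_class_iff[OF equiv_rel assms] by (simp add: normal_class_def)

lemma mem_clsD: "t \<in> cls s \<Longrightarrow> (s, t) \<in> normal_rel S K"
  by (simp add: normal_class_def)

lemma mem_cls_self: "s \<in> carrier S \<Longrightarrow> s \<in> cls s"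
  by (simp add: normal_class_def rel_iff linked_refl)

text \<open>These are the facts that make \<open>\<kappa>\<close>, domain, range and inverse well
  defined on classes. Those on range and inverse rest on the link between ranges in
  \<open>normal_leD\<close>.\<close>

lemma cls_eqD:
  assumes "cls s = cls t" and c: "s \<in> carrier S" "t \<in> carrier S"
  shows "\<phi> s = \<phi> t" and "cls (s \<odot> sinv S s) = cls (t \<odot> sinv S t)"
    and "cls (sinv S s \<odot> s) = cls (sinv S t \<odot> t)" and "cls (sinv S s) = cls (sinv S t)"
proof -
  have rel: "(s, t) \<in> normal_rel S K"
    using assms cls_eq_iff by simp
  then show eq: "\<phi> s = \<phi> t"
    by (simp add: rel_iff)
  show "cls (s \<odot> sinv S s) = cls (t \<odot> sinv S t)"
    using rel c eq by (simp add: cls_eq_iff rel_iff)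
  have l: "linked (sinv S s \<odot> s) (sinv S t \<odot> t)" "linked (sinv S t \<odot> t) (sinv S s \<odot> s)"
    using rel normal_leD(3) by (simp_all add: normal_rel_def)
  then show "cls (sinv S s \<odot> s) = cls (sinv S t \<odot> t)" "cls (sinv S s) = cls (sinv S t)"
    using c eq by (simp_all add: cls_eq_iff rel_iff)
qed

lemma cls_eq_iff_dom:
  assumes c: "s \<in> carrier S" "t \<in> carrier S"
  shows "cls s = cls t \<longleftrightarrow> \<phi> s = \<phi> t \<and> cls (s \<odot> sinv S s) = cls (t \<odot> sinv S t)"
  using cls_eqD[OF _ c] c by (auto simp: cls_eq_iff rel_iff)

section \<open>The quotient groupoid\<close>

abbreviation Q :: "'a set gpd" where
  "Q \<equiv> quotient_groupoid S K"

text \<open>The operations of the quotient are unions over representatives; once the value is the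
  same for all of them, the union over the nonempty class collapses.\<close>

lemma Union_cls_eq:
  assumes "s \<in> carrier S" and "\<And>t. t \<in> carrier S \<Longrightarrow> cls t = cls s \<Longrightarrow> f t = f s"
  shows "(\<Union>t \<in> cls s. f t) = f s"
proof -
  have "f t = f s" if "t \<in> cls s" for t
    using assms mem_clsD[OF that] cls_eq_iff by (metis rel_iff)
  then show ?thesis
    using mem_cls_self[OF assms(1)] by blast
qed

lemma arrows_Q: "arrows Q = cls ` carrier S"
  by (auto simp: quotient_groupoid_def normal_class_def quotient_def)

lemma idents_Q: "idents Q = cls ` idempotents S"
  by (simp add: quotient_groupoid_def)

lemma gdom_Q: "s \<in> carrier S \<Longrightarrow> gdom Q (cls s) = cls (s \<odot> sinv S s)"
  unfolding quotient_groupoid_def gpd.simps by (rule Union_cls_eq) (assumption, (erule cls_eqD(2); assumption))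

lemma gran_Q: "s \<in> carrier S \<Longrightarrow> gran Q (cls s) = cls (sinv S s \<odot> s)"
  unfolding quotient_groupoid_def gpd.simps by (rule Union_cls_eq) (assumption, (erule cls_eqD(3); assumption))

lemma ginv_Q: "s \<in> carrier S \<Longrightarrow> ginv Q (cls s) = cls (sinv S s)"
  unfolding quotient_groupoid_def gpd.simps by (rule Union_cls_eq) (assumption, (erule cls_eqD(4); assumption))

text \<open>The invariants of \<open>s a t\<close> are expressed without \<open>a\<close>, so its
  class cannot depend on the connecting element. The image of \<open>a\<close> is the domain
  identity of \<open>\<phi> t\<close>, which drops out of \<open>\<phi> (s a t)\<close>.\<close>

lemma comp_representative:
  assumes c: "s \<in> carrier S" "t \<in> carrier S" and a: "a \<in> K"
    and sa: "sinv S s \<odot> s \<odot> a = a" and at: "sinv S a \<odot> a = t \<odot> sinv S t"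
    and st: "cls (sinv S s \<odot> s) = cls (t \<odot> sinv S t)"
  shows "\<phi> (s \<odot> a \<odot> t) = \<phi> s \<odot>\<^bsub>T\<^esub> \<phi> t"
    and "cls (s \<odot> a \<odot> t \<odot> sinv S (s \<odot> a \<odot> t)) = cls (s \<odot> sinv S s)"
    and "sinv S (s \<odot> a \<odot> t) \<odot> (s \<odot> a \<odot> t) = sinv S t \<odot> t"
proof -
  have ac: "a \<in> carrier S"
    using a by simp
  have sa': "sinv S s \<odot> (s \<odot> a) = a"
    using sa c ac by simp
  have sa'': "sinv S s \<odot> (s \<odot> (a \<odot> y)) = a \<odot> y" if "y \<in> carrier S" for y
    using arg_cong[OF sa', of "\<lambda>z. z \<odot> y"] that c ac by simp
  have "\<phi> a = \<phi> t \<odot>\<^bsub>T\<^esub> sinv T (\<phi> t)"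
    using phi_K_ran[OF a] c by (simp add: at)
  then show phi: "\<phi> (s \<odot> a \<odot> t) = \<phi> s \<odot>\<^bsub>T\<^esub> \<phi> t"
    using c ac by simp
  have "sinv S (s \<odot> a \<odot> t) \<odot> (s \<odot> a \<odot> t) = sinv S t \<odot> (sinv S a \<odot> a) \<odot> t"
    using c ac sa'' by simp
  also have "\<dots> = sinv S t \<odot> t"
    using c by (simp add: at)
  finally show "sinv S (s \<odot> a \<odot> t) \<odot> (s \<odot> a \<odot> t) = sinv S t \<odot> t" .
  \<comment> \<open>This is the domain of \<open>s a t\<close>: the inner
    \<open>t t\<^sup>-\<^sup>1\<close> equals \<open>a\<^sup>-\<^sup>1 a\<close> and is absorbed by
    \<open>a\<close>.\<close>
  define f where "f = s \<odot> a \<odot> (sinv S a \<odot> sinv S s)"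
  have "s \<odot> a \<odot> t \<odot> sinv S (s \<odot> a \<odot> t) = s \<odot> a \<odot> (t \<odot> sinv S t) \<odot> (sinv S a \<odot> sinv S s)"
    using c ac by simp
  also have "\<dots> = f"
    using c ac by (simp add: f_def flip: at)
  finally have f: "s \<odot> a \<odot> t \<odot> sinv S (s \<odot> a \<odot> t) = f" .
  have fc: "f \<in> carrier S"
    using c ac by (simp add: f_def)
  have fi: "f \<in> idempotents S"
    using S.mult_sinv_idempotent[of "s \<odot> a \<odot> t"] c ac by (simp only: f S.closed)
  have "s \<odot> sinv S s \<odot> f = f"
    using c ac by (simp add: f_def)
  \<comment> \<open>As an idempotent below \<open>s s\<^sup>-\<^sup>1\<close>, \<open>f\<close> is
    itself the link.\<close>
  then have l1: "linked f (s \<odot> sinv S s)"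
    unfolding linked_def using fi K_idempotent S.sinv_idempotent by (metis S.idempotents_iff)
  text \<open>An element \<open>d \<in> K\<close> linking \<open>s\<^sup>-\<^sup>1 s\<close> to \<open>t t\<^sup>-\<^sup>1\<close> is transported along
    \<open>s\<close> after composing with \<open>a\<close>.\<close>
  have "linked (sinv S s \<odot> s) (t \<odot> sinv S t)"
    using st c S.sinv_idempotent by (simp add: cls_eq_iff rel_iff)
  then obtain d where d: "d \<in> K" "sinv S d \<odot> d = sinv S s \<odot> s" "t \<odot> sinv S t \<odot> d = d"
    unfolding linked_def by metis
  have dc: "d \<in> carrier S" and ad: "sinv S a \<odot> (a \<odot> d) = d"
    using d ac at by (simp, metis S.assoc K_closed S.sinv_closed)
  have adi: "sinv S a \<odot> (a \<odot> (d \<odot> y)) = d \<odot> y" if "y \<in> carrier S" for y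
    using arg_cong[OF ad, of "\<lambda>z. z \<odot> y"] that dc ac by simp
  define w where "w = s \<odot> (a \<odot> (d \<odot> sinv S s))"
  have wK: "w \<in> K"
    using K_conj[of "sinv S s" "a \<odot> d"] K_mult[OF a d(1)] c ac dc by (simp add: w_def)
  have "sinv S w \<odot> w = s \<odot> (sinv S d \<odot> d) \<odot> sinv S s"
    using c ac dc sa'' adi by (simp add: w_def)
  also have "\<dots> = s \<odot> sinv S s"
    using c by (simp add: d(2))
  finally have "sinv S w \<odot> w = s \<odot> sinv S s" .
  moreover have "f \<odot> w = w"
    using c ac dc sa'' adi by (simp add: w_def f_def)
  ultimately have "linked (s \<odot> sinv S s) f"
    unfolding linked_def using wK by metis
  moreover have "\<phi> f = \<phi> (s \<odot> sinv S s)"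
  proof -
    have "\<phi> (sinv S s \<odot> s) = \<phi> (t \<odot> sinv S t)"
      using cls_eqD(1)[OF st] c by simp
    then have e: "sinv T (\<phi> s) \<odot>\<^bsub>T\<^esub> \<phi> s = \<phi> t \<odot>\<^bsub>T\<^esub> sinv T (\<phi> t)"
      using c by simp
    have "\<phi> f = \<phi> s \<odot>\<^bsub>T\<^esub> \<phi> t \<odot>\<^bsub>T\<^esub> sinv T (\<phi> s \<odot>\<^bsub>T\<^esub> \<phi> t)"
      using phi c ac by (metis f S.closed phi_mult phi_sinv S.sinv_closed)
    also have "\<dots> = \<phi> s \<odot>\<^bsub>T\<^esub> (\<phi> t \<odot>\<^bsub>T\<^esub> sinv T (\<phi> t)) \<odot>\<^bsub>T\<^esub> sinv T (\<phi> s)"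
      using c by simp
    also have "\<dots> = \<phi> (s \<odot> sinv S s)"
      using c by (simp flip: e)
    finally show ?thesis .
  qed
  ultimately show "cls (s \<odot> a \<odot> t \<odot> sinv S (s \<odot> a \<odot> t)) = cls (s \<odot> sinv S s)"
    unfolding f using l1 c fc S.sinv_idempotent[OF fi] fi
    by (simp add: cls_eq_iff rel_iff S.idempotents_iff)
qed

text \<open>Only the image and the end classes of a representative \<open>u\<close> are exported: by
  \<open>cls_eq_iff_dom\<close> the image and the domain class already fix \<open>cls u\<close>, and
  the range class is what further composition needs.\<close>

lemma gcomp_Q:
  assumes c: "s \<in> carrier S" "t \<in> carrier S"
    and st: "cls (sinv S s \<odot> s) = cls (t \<odot> sinv S t)"
  obtains u where "u \<in> carrier S" "gcomp Q (cls s) (cls t) = cls u"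
    "\<phi> u = \<phi> s \<odot>\<^bsub>T\<^esub> \<phi> t" "cls (u \<odot> sinv S u) = cls (s \<odot> sinv S s)"
    "cls (sinv S u \<odot> u) = cls (sinv S t \<odot> t)"
proof -
  have "linked (t \<odot> sinv S t) (sinv S s \<odot> s)"
    using st c by (simp add: cls_eq_iff rel_iff)
  then obtain a where a: "a \<in> K" "sinv S a \<odot> a = t \<odot> sinv S t" "sinv S s \<odot> s \<odot> a = a"
    unfolding linked_def by metis
  define u where "u = s \<odot> a \<odot> t"
  have uc: "u \<in> carrier S"
    using a c by (simp add: u_def)
  note u = comp_representative[OF c a(1,3,2) st, folded u_def]
  let ?C = "{normal_class S K (x \<odot> b \<odot> y) | x b y.
       x \<in> cls s \<and> y \<in> cls t \<and> b \<in> K \<and>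
       natural_le S (b \<odot> sinv S b) (sinv S x \<odot> x) \<and> sinv S b \<odot> b = y \<odot> sinv S y}"
  \<comment> \<open>Inverting \<open>s\<^sup>-\<^sup>1 s a a\<^sup>-\<^sup>1 = a
    a\<^sup>-\<^sup>1\<close> puts the idempotent on the left, as \<open>natural_le\<close>
    demands.\<close>
  have "a \<odot> sinv S a = a \<odot> sinv S a \<odot> (sinv S s \<odot> s)"
    using arg_cong[OF arg_cong[OF a(3), of "\<lambda>z. z \<odot> sinv S a"], of "sinv S"] a(1) c by simp
  then have "natural_le S (a \<odot> sinv S a) (sinv S s \<odot> s)"
    unfolding natural_le_def using a(1) c
    by (metis S.closed S.mult_sinv_idempotent S.sinv_closed K_closed)
  then have "cls u \<in> ?C"
    using a c mem_cls_self u_def by blast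
  \<comment> \<open>Any other choice of representatives and connecting element has the same image
    and domain class, so \<open>?C\<close> has \<open>cls u\<close> as its only member.\<close>
  moreover have "X = cls u" if X: "X \<in> ?C" for X
  proof -
    obtain x b y where xy: "x \<in> cls s" "y \<in> cls t" and b: "b \<in> K" "sinv S b \<odot> b = y \<odot> sinv S y"
      and le: "natural_le S (b \<odot> sinv S b) (sinv S x \<odot> x)" and X: "X = cls (x \<odot> b \<odot> y)"
      using X by blast
    have xyc: "x \<in> carrier S" "y \<in> carrier S" and eq: "cls x = cls s" "cls y = cls t"
      using mem_clsD[OF xy(1)] mem_clsD[OF xy(2)] cls_eq_iff c by (metis rel_iff)+
    have "sinv S x \<odot> x \<odot> b = b"
      using arg_cong[OF S.natural_leD(1)[OF le], of "\<lambda>z. z \<odot> b"] b(1) xyc by simp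
    moreover have "cls (sinv S x \<odot> x) = cls (y \<odot> sinv S y)"
      using st cls_eqD[OF eq(1)] cls_eqD[OF eq(2)] xyc c by simp
    ultimately have "\<phi> (x \<odot> b \<odot> y) = \<phi> u" "cls (x \<odot> b \<odot> y \<odot> sinv S (x \<odot> b \<odot> y)) = cls (u \<odot> sinv S u)"
      using comp_representative(1,2)[OF xyc b(1) _ b(2)] u cls_eqD(1,2)[OF eq(1)]
        cls_eqD(1)[OF eq(2)] xyc c by metis+
    then show ?thesis
      unfolding X using uc xyc b by (subst cls_eq_iff_dom) (simp_all del: S.sinv_mult S.assoc)
  qed
  ultimately have "\<Union>?C = cls u"
    by blast
  then have "gcomp Q (cls s) (cls t) = cls u"
    by (simp add: quotient_groupoid_def)
  then show ?thesis
    using that uc u by simp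
qed

lemma groupoid_Q: "groupoid Q"
proof
  show "idents Q \<subseteq> arrows Q"
    by (auto simp: idents_Q arrows_Q S.idempotents_iff)
next
  fix e assume "e \<in> idents Q"
  then obtain x where x: "x \<in> idempotents S" "e = cls x"
    by (auto simp: idents_Q)
  then show "gdom Q e = e" "gran Q e = e"
    using S.sinv_idempotent[of x] by (simp_all add: S.idempotents_iff gdom_Q gran_Q)
next
  fix g assume "g \<in> arrows Q"
  then obtain s where s: "s \<in> carrier S" "g = cls s"
    by (auto simp: arrows_Q)
  show "gdom Q g \<in> idents Q" "gran Q g \<in> idents Q"
    using s by (simp_all add: gdom_Q gran_Q idents_Q)
  show "ginv Q g \<in> arrows Q" "gdom Q (ginv Q g) = gran Q g" "gran Q (ginv Q g) = gdom Q g"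
    using s by (simp_all add: gdom_Q gran_Q ginv_Q arrows_Q)
  \<comment> \<open>The unit and inverse laws all have this shape: the proposed product
    \<open>z\<close> has the right image and shares its domain with \<open>x\<close>.\<close>
  have *: "gcomp Q (cls x) (cls y) = cls z"
    if "x \<in> carrier S" "y \<in> carrier S" "z \<in> carrier S"
      "cls (sinv S x \<odot> x) = cls (y \<odot> sinv S y)" "\<phi> z = \<phi> x \<odot>\<^bsub>T\<^esub> \<phi> y"
      "z \<odot> sinv S z = x \<odot> sinv S x" for x y z
    using gcomp_Q[OF that(1,2,4)] that(3,5,6) by (metis cls_eq_iff_dom)
  show "gcomp Q (gdom Q g) g = g"
    unfolding s(2) gdom_Q[OF s(1)] by (rule *) (use s in simp_all)
  show "gcomp Q g (gran Q g) = g"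
    unfolding s(2) gran_Q[OF s(1)] by (rule *) (use s in simp_all)
  show "gcomp Q g (ginv Q g) = gdom Q g"
    unfolding s(2) gdom_Q[OF s(1)] ginv_Q[OF s(1)] by (rule *) (use s in simp_all)
  show "gcomp Q (ginv Q g) g = gran Q g"
    unfolding s(2) gran_Q[OF s(1)] ginv_Q[OF s(1)] by (rule *) (use s in simp_all)
next
  fix g h assume g: "g \<in> arrows Q" and h: "h \<in> arrows Q" and gh: "gran Q g = gdom Q h"
  obtain s t where s: "s \<in> carrier S" "g = cls s" and t: "t \<in> carrier S" "h = cls t"
    using g h by (auto simp: arrows_Q)
  have st: "cls (sinv S s \<odot> s) = cls (t \<odot> sinv S t)"
    using gh s t by (simp add: gdom_Q gran_Q)
  obtain u where u: "u \<in> carrier S" "gcomp Q g h = cls u" "\<phi> u = \<phi> s \<odot>\<^bsub>T\<^esub> \<phi> t"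
    "cls (u \<odot> sinv S u) = cls (s \<odot> sinv S s)" "cls (sinv S u \<odot> u) = cls (sinv S t \<odot> t)"
    using gcomp_Q[OF s(1) t(1) st] s t by metis
  show "gcomp Q g h \<in> arrows Q" "gdom Q (gcomp Q g h) = gdom Q g"
    "gran Q (gcomp Q g h) = gran Q h"
    using u s t by (simp_all add: arrows_Q gdom_Q gran_Q)
  fix k assume k: "k \<in> arrows Q" and hk: "gran Q h = gdom Q k"
  obtain r where r: "r \<in> carrier S" "k = cls r"
    using k by (auto simp: arrows_Q)
  have tr: "cls (sinv S t \<odot> t) = cls (r \<odot> sinv S r)"
    using hk t r by (simp add: gdom_Q gran_Q)
  obtain v where v: "v \<in> carrier S" "gcomp Q h k = cls v" "\<phi> v = \<phi> t \<odot>\<^bsub>T\<^esub> \<phi> r"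
    "cls (v \<odot> sinv S v) = cls (t \<odot> sinv S t)"
    using gcomp_Q[OF t(1) r(1) tr] t r by metis
  obtain x where x: "x \<in> carrier S" "gcomp Q (cls u) k = cls x" "\<phi> x = \<phi> u \<odot>\<^bsub>T\<^esub> \<phi> r"
    "cls (x \<odot> sinv S x) = cls (u \<odot> sinv S u)"
    using gcomp_Q[OF u(1) r(1)] tr u(5) r by metis
  obtain y where y: "y \<in> carrier S" "gcomp Q g (cls v) = cls y" "\<phi> y = \<phi> s \<odot>\<^bsub>T\<^esub> \<phi> v"
    "cls (y \<odot> sinv S y) = cls (s \<odot> sinv S s)"
    using gcomp_Q[OF s(1) v(1)] st v(4) s by metis
  \<comment> \<open>Both bracketings have image \<open>\<phi> s \<phi> t \<phi> r\<close>, by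
    associativity in \<open>T\<close>, and the domain class of \<open>s\<close>.\<close>
  have "cls x = cls y"
    using x y u v s t r by (subst cls_eq_iff_dom) simp_all
  then show "gcomp Q (gcomp Q g h) k = gcomp Q g (gcomp Q h k)"
    using u v x y by simp
qed

section \<open>The factor map from the quotient groupoid\<close>

definition \<kappa> :: "'a set \<Rightarrow> 'b" where
  "\<kappa> X = the_elem (\<phi> ` X)"

text \<open>Since \<open>\<phi>\<close> is constant on a class, its image there is a singleton and
  \<open>the_elem\<close> picks the common value.\<close>

lemma kappa_cls [simp]:
  assumes "s \<in> carrier S"
  shows "\<kappa> (cls s) = \<phi> s"
proof -
  have "\<phi> t = \<phi> s" if "t \<in> cls s" for t
    using mem_clsD[OF that] by (simp add: rel_iff)
  then have "\<phi> ` cls s = {\<phi> s}"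
    using mem_cls_self[OF assms] by blast
  then show ?thesis
    by (simp add: \<kappa>_def)
qed

lemma groupoid_functor_kappa: "groupoid_functor Q (trace_groupoid T) \<kappa>"
  unfolding groupoid_functor_def groupoid_functor_axioms_def
proof (intro conjI allI impI)
  fix g h assume "g \<in> arrows Q" "h \<in> arrows Q" and gh: "gran Q g = gdom Q h"
  then obtain s t where s: "s \<in> carrier S" "g = cls s" and t: "t \<in> carrier S" "h = cls t"
    by (auto simp: arrows_Q)
  then have "cls (sinv S s \<odot> s) = cls (t \<odot> sinv S t)"
    using gh by (simp add: gdom_Q gran_Q)
  from gcomp_Q[OF s(1) t(1) this]
  show "\<kappa> (gcomp Q g h) = gcomp (trace_groupoid T) (\<kappa> g) (\<kappa> h)"
    using s t by (metis gpd.simps(5) kappa_cls trace_groupoid_def)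
next
  fix e assume "e \<in> idents Q"
  then obtain x where x: "x \<in> idempotents S" "e = cls x"
    by (auto simp: idents_Q)
  then have "\<kappa> e = \<phi> x"
    by (simp add: S.idempotents_iff)
  then show "\<kappa> e \<in> idents (trace_groupoid T)"
    using phi_idempotent[OF x(1)] by (simp add: trace_groupoid_def)
qed (use groupoid_Q T.groupoid_trace_groupoid in
    \<open>auto simp: arrows_Q gdom_Q gran_Q trace_groupoid_def\<close>)

text \<open>Representatives of two arrows in one star have the same domain class, and equal values
  of \<open>\<kappa>\<close> mean equal values of \<open>\<phi>\<close>;
  \<open>cls_eq_iff_dom\<close> then identifies the arrows.\<close>

lemma star_injective_kappa: "star_injective Q (trace_groupoid T) \<kappa>"
  unfolding star_injective_def
proof (intro ballI conjI)
  interpret Q: groupoid Q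
    by (rule groupoid_Q)
  fix e assume "e \<in> idents Q"
  \<comment> \<open>A star is defined through \<open>g g\<^sup>-\<^sup>1\<close>, which the groupoid
    law \<open>comp_inv\<close> turns into the domain of \<open>g\<close>.\<close>
  have star: "\<exists>s \<in> carrier S. g = cls s \<and> e = cls (s \<odot> sinv S s)" if "g \<in> star Q e" for g
    using that Q.comp_inv by (auto simp: star_def arrows_Q gdom_Q)
  show "\<kappa> ` star Q e \<subseteq> star (trace_groupoid T) (\<kappa> e)"
  proof
    fix x assume "x \<in> \<kappa> ` star Q e"
    then obtain g where g: "g \<in> star Q e" "x = \<kappa> g"
      by blast
    then obtain s where "s \<in> carrier S" "g = cls s" "e = cls (s \<odot> sinv S s)"
      using star by blast
    then show "x \<in> star (trace_groupoid T) (\<kappa> e)"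
      using g(2) by (simp add: star_def trace_groupoid_def)
  qed
  show "inj_on \<kappa> (star Q e)"
  proof (rule inj_onI)
    fix g h assume g: "g \<in> star Q e" and h: "h \<in> star Q e" and eq: "\<kappa> g = \<kappa> h"
    obtain s where s: "s \<in> carrier S" "g = cls s" "e = cls (s \<odot> sinv S s)"
      using star[OF g] by blast
    obtain t where t: "t \<in> carrier S" "h = cls t" "e = cls (t \<odot> sinv S t)"
      using star[OF h] by blast
    show "g = h"
      unfolding s(2) t(2) cls_eq_iff_dom[OF s(1) t(1)]
      using eq s t by (metis kappa_cls)
  qed
qed

end

theorem corollary2p7:
  fixes S :: "'a sgp" and \<Sigma> :: "'b sgp" and \<phi> :: "'a \<Rightarrow> 'b" and K :: "'a set"
  assumes "inverse_semigroup S" and "inverse_semigroup \<Sigma>"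
    and "\<phi> \<in> sgp_hom S \<Sigma>"
    and "K = {s \<in> carrier S. \<phi> s \<in> idempotents \<Sigma>}"
  shows "normal_inverse_subsemigroup K S \<and>
    (\<exists>\<kappa> :: 'a set \<Rightarrow> 'b.
       (\<forall>s \<in> carrier S. \<kappa> (normal_class S K s) = \<phi> s) \<and>
       groupoid_functor (quotient_groupoid S K) (trace_groupoid \<Sigma>) \<kappa> \<and>
       star_injective (quotient_groupoid S K) (trace_groupoid \<Sigma>) \<kappa>)"
proof -
  interpret h: inverse_semigroup_hom S \<Sigma> \<phi>
    using assms by (simp add: inverse_semigroup_hom_def inverse_semigroup_hom_axioms_def)
  have K: "K = h.K"
    unfolding assms(4) h.K_def ..
  show ?thesis
    unfolding K
    using h.normal_K h.kappa_cls h.groupoid_functor_kappa h.star_injective_kappa by blast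
qed

end
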